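(* Let $E\in(-2,2)$, $0<R<\infty$ and $0\le\sigma<\infty$. There exists a constant $c$ such that for all sufficiently large $n$ and all $t>0$, the following two statements hold with probability at least $1-c/t$. (1) $$\max_{0\le \ell\le n,\ |\lambda|\le R}\mathrm{Tr}\, M_\ell^\lambda (M_\ell^\lambda)^* < t,$$ where the maximum is over integers $0\le\ell\le n$ and $\lambda\in\mathbb C$ with $|\lambda|\le R$. (2) For each eigenvector $\psi=(\psi_1,\dots,\psi_n)$ of $H_n$, normalized by $\sum_{\ell=1}^n|\psi_\ell|^2=1$ and corresponding to an eigenvalue $\mu\in\left[E-\frac{R}{\rho n},E+\frac{R}{\rho n}\right]$, we have (with the convention $\psi_0=\psi_{n+1}=0$) $$\frac{2}{(n+1)t^2}<|\psi_\ell|^2+|\psi_{\ell+1}|^2<\frac{2t^2}{n+1},\qquad 0\le \ell\le n.$$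
   Context: Let $\omega_1,\omega_2,\dots$ be independent real random variables with mean $0$, variance $1$ and uniformly bounded third absolute moments ($\sup_k \mathbb E|\omega_k|^3<\infty$). $H_n$ is the random symmetric tridiagonal $n\times n$ matrix with diagonal entries $v_k=\sigma\omega_k/\sqrt n$, $1\le k\le n$, and all entries directly above and below the diagonal equal to $1$. Put $\rho=\rho(E)=1/\sqrt{1-E^2/4}$, $T(x)=\begin{pmatrix}x&-1\\1&0\end{pmatrix}$, $\varepsilon_\ell=\frac{\lambda}{\rho n}-\frac{\sigma\omega_\ell}{\sqrt n}$, and for $\lambda\in\mathbb C$, $0\le\ell\le n$, let $M_\ell^\lambda=T(E+\varepsilon_\ell)T(E+\varepsilon_{\ell-1})\cdots T(E+\varepsilon_1)$, $M_0^\lambda=I$ (these are the transfer matrices of the eigenvalue equation $H_n\psi=\mu\psi$ with $\mu=E+\frac{\lambda}{\rho n}$). *)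

theory Defs
  imports "HOL-Probability.Probability" "Jordan_Normal_Form.Char_Poly"
begin

unbundle no vec_syntax

definition rho :: "real \<Rightarrow> real" where
  "rho E = 1 / sqrt (1 - E\<^sup>2 / 4)"

text \<open>In the definitions below \<open>w k\<close> is the realised value of the \<open>k\<close>-th random variable
  (\<open>k \<ge> 1\<close>; \<open>w 0\<close> is never used), and matrix rows and columns of \<open>H\<close> are indexed from \<open>0\<close>.\<close>

definition H :: "real \<Rightarrow> nat \<Rightarrow> (nat \<Rightarrow> real) \<Rightarrow> complex mat" where
  "H \<sigma> n w = mat n n (\<lambda>(i, j).
     if i = j then complex_of_real (\<sigma> * w (Suc i) / sqrt (real n))
     else if i = Suc j \<or> j = Suc i then 1
     else 0)"

definition T :: "complex \<Rightarrow> complex^2^2" where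
  "T x = vector [vector [x, -1], vector [1, 0]]"

definition eps :: "real \<Rightarrow> real \<Rightarrow> nat \<Rightarrow> (nat \<Rightarrow> real) \<Rightarrow> complex \<Rightarrow> nat \<Rightarrow> complex" where
  "eps E \<sigma> n w z l =
     z / complex_of_real (rho E * real n) - complex_of_real (\<sigma> * w l / sqrt (real n))"

primrec transfer ::
    "real \<Rightarrow> real \<Rightarrow> nat \<Rightarrow> (nat \<Rightarrow> real) \<Rightarrow> complex \<Rightarrow> nat \<Rightarrow> complex^2^2" where
  "transfer E \<sigma> n w z 0 = Finite_Cartesian_Product.mat 1"
| "transfer E \<sigma> n w z (Suc l) =
     T (complex_of_real E + eps E \<sigma> n w z (Suc l)) ** transfer E \<sigma> n w z l"

definition conj_transpose :: "complex^2^2 \<Rightarrow> complex^2^2" where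
  "conj_transpose A = map_matrix cnj (Finite_Cartesian_Product.transpose A)"

text \<open>The trace of \<open>A A\<^sup>*\<close> is real, so taking the real part loses nothing.\<close>

definition tr_AAstar :: "complex^2^2 \<Rightarrow> real" where
  "tr_AAstar A = Re (trace (A ** conj_transpose A))"

text \<open>Entries of \<open>\<psi>\<close> numbered \<open>1, \<dots>, n\<close>, with value \<open>0\<close> at all other indices,
  in particular at \<open>0\<close> and \<open>n + 1\<close>.\<close>

definition coord :: "nat \<Rightarrow> complex Matrix.vec \<Rightarrow> nat \<Rightarrow> complex" where
  "coord n \<psi> l = (if 1 \<le> l \<and> l \<le> n then vec_index \<psi> (l - 1) else 0)"

text \<open>The maximum over \<open>l \<le> n\<close> and the closed disc is attained by continuity in \<open>z\<close>,
  so it is less than \<open>t\<close> iff every value is.\<close>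

definition transfer_bounded ::
    "real \<Rightarrow> real \<Rightarrow> real \<Rightarrow> nat \<Rightarrow> (nat \<Rightarrow> real) \<Rightarrow> real \<Rightarrow> bool" where
  "transfer_bounded E R \<sigma> n w t \<longleftrightarrow>
     (\<forall>l\<le>n. \<forall>z::complex. cmod z \<le> R \<longrightarrow> tr_AAstar (transfer E \<sigma> n w z l) < t)"

definition eigenvectors_delocalized ::
    "real \<Rightarrow> real \<Rightarrow> real \<Rightarrow> nat \<Rightarrow> (nat \<Rightarrow> real) \<Rightarrow> real \<Rightarrow> bool" where
  "eigenvectors_delocalized E R \<sigma> n w t \<longleftrightarrow>
     (\<forall>\<psi> \<mu>. eigenvector (H \<sigma> n w) \<psi> (complex_of_real \<mu>) \<longrightarrow>
        (\<Sum>l=1..n. (cmod (coord n \<psi> l))\<^sup>2) = 1 \<longrightarrow>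
        \<mu> \<in> {E - R / (rho E * real n) .. E + R / (rho E * real n)} \<longrightarrow>
        (\<forall>l\<le>n.
           2 / ((real n + 1) * t\<^sup>2) < (cmod (coord n \<psi> l))\<^sup>2 + (cmod (coord n \<psi> (l + 1)))\<^sup>2 \<and>
           (cmod (coord n \<psi> l))\<^sup>2 + (cmod (coord n \<psi> (l + 1)))\<^sup>2 < 2 * t\<^sup>2 / (real n + 1)))"

end

theory Submission
  imports Defs
begin

text \<open>
  Statement (1) implies statement (2) pointwise. An eigenvector with eigenvalue
  \<open>E + z / (\<rho> n)\<close> satisfies \<open>(\<psi>\<^sub>l\<^sub>+\<^sub>1, \<psi>\<^sub>l) = M\<^sub>l (\<psi>\<^sub>1, 0)\<close>, and since \<open>det M\<^sub>l = 1\<close>, a bound \<open>Tr M\<^sub>l M\<^sub>l\<^sup>* < t\<close>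
  controls the first column of \<open>M\<^sub>l\<close> from above and from below. Hence any two of the \<open>n + 1\<close> numbers
  \<open>\<bar>\<psi>\<^sub>l\<bar>\<^sup>2 + \<bar>\<psi>\<^sub>l\<^sub>+\<^sub>1\<bar>\<^sup>2\<close> differ by a factor less than \<open>t\<^sup>2\<close>; as they sum to \<open>2\<close>, each of them lies
  within that factor of \<open>2 / (n + 1)\<close>. The event of the theorem is therefore the event (1).

  For (1), one has to control a maximum over \<open>l\<close> and a supremum over the disc \<open>\<bar>z\<bar> \<le> R\<close> at once. The
  entries of \<open>M\<^sub>l\<close> are polynomials in \<open>\<zeta> = z / (2 R)\<close>, and for \<open>\<bar>\<zeta>\<bar> \<le> 1/2\<close> the Cauchy-Schwarz inequality
  bounds such a polynomial by the \<open>\<ell>\<^sup>2\<close> norm of its coefficients, uniformly in \<open>\<zeta>\<close>. So it suffices to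
  control, for each of the two columns of \<open>M\<^sub>l\<close>, a quadratic functional of the coefficient sequences
  \<open>x\<close>, \<open>y\<close> of its two entries. The right choice is the energy \<open>\<Sum>\<^sub>j x\<^sub>j\<^sup>2 - E x\<^sub>j y\<^sub>j + y\<^sub>j\<^sup>2\<close>: the unperturbed step
  \<open>(x, y) \<mapsto> (E x - y, x)\<close> leaves it invariant, and \<open>\<bar>E\<bar> < 2\<close> makes it positive definite. The
  perturbation adds to \<open>x\<close> a noise of size \<open>n\<^sup>-\<^sup>1\<^sup>/\<^sup>2\<close>, centred and independent of the past, and a shift of
  size \<open>1/n\<close>. In conditional expectation the energy thus changes only by a factor \<open>1 + O(1/n)\<close>
  (\<open>energy_step\<close>, \<open>energy_drift_bound\<close>).

  A nonnegative process whose conditional expectation changes by factors between \<open>1 - a\<close> and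
  \<open>1 + a\<close> satisfies Doob's weak maximal inequality up to a factor \<open>exp (3 n a)\<close>
  (\<open>maximal_inequality\<close>); with \<open>a = C / n\<close> the tail bound \<open>c / t\<close> holds with \<open>c\<close> independent of \<open>n\<close>.
\<close>

(* From here on, $ selects the entries of vectors and matrices indexed by finite types. *)
no_notation vec_index (infixl \<open>$\<close> 100)
unbundle vec_syntax

section \<open>A maximal inequality for nearly conserved quadratic processes\<close>

text \<open>The \<open>\<sigma>\<close>-algebra generated by \<open>X 1, \<dots>, X l\<close>.\<close>

definition past :: "'a measure \<Rightarrow> (nat \<Rightarrow> 'a \<Rightarrow> real) \<Rightarrow> nat \<Rightarrow> 'a measure" where
  "past M X l =
     vimage_algebra (space M) (\<lambda>x. \<lambda>i\<in>{1..l}. X i x) (PiM {1..l} (\<lambda>_. borel))"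

lemma space_past [simp]: "space (past M X l) = space M"
  by (simp add: past_def)

lemma measurable_past_component:
  assumes "1 \<le> k" "k \<le> l"
  shows "X k \<in> borel_measurable (past M X l)"
proof -
  have "(\<lambda>x. \<lambda>i\<in>{1..l}. X i x) \<in> past M X l \<rightarrow>\<^sub>M PiM {1..l} (\<lambda>_. borel)"
    unfolding past_def by (rule measurable_vimage_algebra1) (auto simp: space_PiM)
  from measurable_compose[OF this measurable_component_singleton[of k]]
  show ?thesis using assms by simp
qed

lemma sets_past_subset:
  assumes "\<And>k. k \<ge> 1 \<Longrightarrow> X k \<in> borel_measurable M"
  shows "sets (past M X l) \<subseteq> sets M"
  unfolding past_def
  by (rule sets_image_in_sets) (use assms in \<open>auto intro!: measurable_restrict\<close>)

text \<open>The \<open>\<sigma>\<close>-algebras generated by the two blocks \<open>X 1, \<dots>, X l\<close> and \<open>X (l + 1)\<close> are independent;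
  those generated by \<open>Z\<close> and \<open>X (l + 1)\<close> are contained in them.\<close>

lemma (in prob_space) indep_var_past:
  assumes indep: "indep_vars (\<lambda>_. borel) X {1..}" and Z: "Z \<in> borel_measurable (past M X l)"
  shows "indep_var borel Z borel (X (Suc l))"
proof -
  let ?P = "\<lambda>x. \<lambda>i\<in>{1..l}. X i x"
  let ?P' = "\<lambda>x. \<lambda>i\<in>{Suc l}. X i x"
  have "indep_var (PiM {1..l} (\<lambda>_. borel)) ?P (PiM {Suc l} (\<lambda>_. borel)) ?P'"
    by (rule indep_var_restrict[OF indep]) auto
  then have base: "random_variable (PiM {1..l} (\<lambda>_. borel)) ?P"
    "random_variable (PiM {Suc l} (\<lambda>_. borel)) ?P'"
    "indep_set (sigma_sets (space M) {?P -` A \<inter> space M | A. A \<in> sets (PiM {1..l} (\<lambda>_. borel))})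
       (sigma_sets (space M) {?P' -` A \<inter> space M | A. A \<in> sets (PiM {Suc l} (\<lambda>_. borel))})"
    (is "indep_set ?G ?G'")
    unfolding indep_var_eq by auto
  have rX: "random_variable borel (X k)" if "k \<ge> 1" for k
    using indep that by (auto simp: indep_vars_def)
  have Zs: "Z -` A \<inter> space M \<in> ?G" if "A \<in> sets borel" for A
    using measurable_sets[OF Z that] by (simp add: past_def sets_vimage_algebra)
  have "sets (past M X l) \<subseteq> events"
    by (rule sets_past_subset[OF rX])
  then have rZ: "random_variable borel Z"
    using Z by (auto simp: measurable_def)
  have G: "sigma_sets (space M) {Z -` A \<inter> space M | A. A \<in> sets borel} \<subseteq> ?G"
    by (rule sigma_sets_mono) (use Zs in auto)
  have "X (Suc l) -` A \<inter> space M \<in> ?G'" if "A \<in> sets borel" for A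
  proof -
    have "(\<lambda>f. f (Suc l)) -` A \<inter> space (PiM {Suc l} (\<lambda>_. borel)) \<in> sets (PiM {Suc l} (\<lambda>_. borel))"
      using that by (intro measurable_sets[OF measurable_component_singleton]) auto
    moreover have "X (Suc l) -` A \<inter> space M =
        ?P' -` ((\<lambda>f. f (Suc l)) -` A \<inter> space (PiM {Suc l} (\<lambda>_. borel))) \<inter> space M"
      by (auto simp: space_PiM)
    ultimately show ?thesis by (intro sigma_sets.Basic) blast
  qed
  then have G': "sigma_sets (space M) {X (Suc l) -` A \<inter> space M | A. A \<in> sets borel} \<subseteq> ?G'"
    by (intro sigma_sets_mono) auto
  show ?thesis
    unfolding indep_var_eq indep_set_def
    using indep_sets_mono_sets[OF base(3)[unfolded indep_set_def], of
        "case_bool (sigma_sets (space M) {Z -` A \<inter> space M | A. A \<in> sets borel})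
          (sigma_sets (space M) {X (Suc l) -` A \<inter> space M | A. A \<in> sets borel})"]
      rZ rX[of "Suc l"] G G' by (auto split: bool.split)
qed

text \<open>Since \<open>X (l + 1)\<close> is independent of the past with mean \<open>0\<close> and second moment \<open>1\<close>, the conditional
  expectation of \<open>Y (l + 1)\<close> given the past is \<open>D l + Q l\<close>; the assumption \<open>drift\<close> says that it
  differs from \<open>Y l\<close> by a factor between \<open>1 - a\<close> and \<open>1 + a\<close>. The bounds by \<open>K\<close> serve
  integrability.\<close>

locale nearly_martingale = prob_space M for M :: "'a measure" +
  fixes X Y D L Q :: "nat \<Rightarrow> 'a \<Rightarrow> real" and y\<^sub>0 a K :: real
  assumes indep: "indep_vars (\<lambda>_. borel) X {1..}"
    and int_X: "\<And>k. k \<ge> 1 \<Longrightarrow> integrable M (X k)"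
    and mean_X: "\<And>k. k \<ge> 1 \<Longrightarrow> expectation (X k) = 0"
    and int_X2: "\<And>k. k \<ge> 1 \<Longrightarrow> integrable M (\<lambda>x. (X k x)\<^sup>2)"
    and mean_X2: "\<And>k. k \<ge> 1 \<Longrightarrow> expectation (\<lambda>x. (X k x)\<^sup>2) = 1"
    and Y_0: "\<And>x. x \<in> space M \<Longrightarrow> Y 0 x = y\<^sub>0"
    and Y_Suc: "\<And>l x. x \<in> space M \<Longrightarrow>
      Y (Suc l) x = D l x + X (Suc l) x * L l x + (X (Suc l) x)\<^sup>2 * Q l x"
    and Y_adapted: "\<And>k l. k \<le> l \<Longrightarrow> Y k \<in> borel_measurable (past M X l)"
    and D_adapted: "\<And>l. D l \<in> borel_measurable (past M X l)"
    and L_adapted: "\<And>l. L l \<in> borel_measurable (past M X l)"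
    and Q_adapted: "\<And>l. Q l \<in> borel_measurable (past M X l)"
    and Y_nonneg: "\<And>l x. x \<in> space M \<Longrightarrow> 0 \<le> Y l x"
    and L_bound: "\<And>l x. x \<in> space M \<Longrightarrow> \<bar>L l x\<bar> \<le> K * Y l x"
    and Q_bound: "\<And>l x. x \<in> space M \<Longrightarrow> \<bar>Q l x\<bar> \<le> K * Y l x"
    and drift: "\<And>l x. x \<in> space M \<Longrightarrow> \<bar>D l x + Q l x - Y l x\<bar> \<le> a * Y l x"
begin

lemma borel_measurable_of_past:
  fixes Z :: "'a \<Rightarrow> real"
  shows "Z \<in> borel_measurable (past M X l) \<Longrightarrow> Z \<in> borel_measurable M"
  by (rule indep_var_rv1[OF indep_var_past[OF indep]])

lemma events_of_past: "A \<in> sets (past M X l) \<Longrightarrow> A \<in> events"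
  using sets_past_subset[of X M l] indep by (auto simp: indep_vars_def)

lemma integrable_dominated_by_Y:
  assumes "integrable M (Y l)" "Z \<in> borel_measurable (past M X l)"
    and "\<And>x. x \<in> space M \<Longrightarrow> \<bar>Z x\<bar> \<le> C * Y l x"
  shows "integrable M Z"
proof (rule Bochner_Integration.integrable_bound)
  show "integrable M (\<lambda>x. C * Y l x)"
    using assms(1) by simp
  show "AE x in M. norm (Z x) \<le> norm (C * Y l x)"
    using assms(3) by (intro AE_I2) fastforce
qed (rule borel_measurable_of_past[OF assms(2)])

text \<open>The conditional expectation of \<open>Y (l + 1)\<close>, in the weak form of testing against weights \<open>J\<close>
  that depend on the past.\<close>

lemma one_step:
  assumes Y: "integrable M (Y l)"
    and J: "J \<in> borel_measurable (past M X l)" "\<And>x. 0 \<le> J x" "\<And>x. J x \<le> (1::real)"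
  shows "integrable M (\<lambda>x. J x * Y (Suc l) x)" (is ?int)
    and "integrable M (\<lambda>x. J x * (D l x + Q l x))" (is ?intDQ)
    and "expectation (\<lambda>x. J x * Y (Suc l) x) = expectation (\<lambda>x. J x * (D l x + Q l x))" (is ?eq)
proof -
  note [measurable] = D_adapted[of l] L_adapted[of l] Q_adapted[of l] Y_adapted[of l l, simplified] J(1)
  have J_le: "\<bar>J x * z\<bar> \<le> B" if "\<bar>z\<bar> \<le> B" for x z B
  proof -
    have "\<bar>J x * z\<bar> = J x * \<bar>z\<bar>" using J(2)[of x] by (simp add: abs_mult)
    also have "\<dots> \<le> 1 * \<bar>z\<bar>" using J(3)[of x] by (intro mult_right_mono) auto
    finally show ?thesis using that by simp
  qed
  have JL: "integrable M (\<lambda>x. J x * L l x)"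
    by (rule integrable_dominated_by_Y[OF Y, where C = K]) (measurable, use L_bound J_le in auto)
  have JQ: "integrable M (\<lambda>x. J x * Q l x)"
    by (rule integrable_dominated_by_Y[OF Y, where C = K]) (measurable, use Q_bound J_le in auto)
  have "\<bar>D l x\<bar> \<le> (a + 1 + K) * Y l x" if "x \<in> space M" for x
    using drift[OF that, of l] Q_bound[OF that, of l] Y_nonneg[OF that, of l]
    by (simp add: algebra_simps)
  then have JD: "integrable M (\<lambda>x. J x * D l x)"
    by (intro integrable_dominated_by_Y[OF Y, where C = "a + 1 + K"]) (measurable, use J_le in auto)
  have indL: "indep_var borel (\<lambda>x. J x * L l x) borel (X (Suc l))"
    by (rule indep_var_past[OF indep]) measurable
  have "indep_var borel (\<lambda>x. J x * Q l x) borel (X (Suc l))"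
    by (rule indep_var_past[OF indep]) measurable
  then have "indep_var borel ((\<lambda>z. z) \<circ> (\<lambda>x. J x * Q l x)) borel ((\<lambda>z. z\<^sup>2) \<circ> X (Suc l))"
    by (rule indep_var_compose) auto
  then have indQ: "indep_var borel (\<lambda>x. J x * Q l x) borel (\<lambda>x. (X (Suc l) x)\<^sup>2)"
    by (simp add: comp_def)
  have intL: "integrable M (\<lambda>x. (J x * L l x) * X (Suc l) x)"
    by (rule indep_var_integrable[OF indL JL]) (simp add: int_X)
  have eL: "expectation (\<lambda>x. (J x * L l x) * X (Suc l) x) = 0"
    by (subst indep_var_lebesgue_integral[OF indL JL]) (simp_all add: int_X mean_X)
  have intQ: "integrable M (\<lambda>x. (J x * Q l x) * (X (Suc l) x)\<^sup>2)"
    by (rule indep_var_integrable[OF indQ JQ]) (simp add: int_X2)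
  have eQ: "expectation (\<lambda>x. (J x * Q l x) * (X (Suc l) x)\<^sup>2) = expectation (\<lambda>x. J x * Q l x)"
    by (subst indep_var_lebesgue_integral[OF indQ JQ]) (simp_all add: int_X2 mean_X2)
  have split: "J x * Y (Suc l) x =
      J x * D l x + (J x * L l x) * X (Suc l) x + (J x * Q l x) * (X (Suc l) x)\<^sup>2"
    if "x \<in> space M" for x
    using Y_Suc[OF that, of l] by (simp add: algebra_simps)
  show ?int
    by (subst Bochner_Integration.integrable_cong[OF refl split]) (use JD intL intQ in auto)
  show ?intDQ
    using JD JQ by (simp add: distrib_left)
  have "expectation (\<lambda>x. J x * Y (Suc l) x) = expectation
      (\<lambda>x. J x * D l x + (J x * L l x) * X (Suc l) x + (J x * Q l x) * (X (Suc l) x)\<^sup>2)"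
    by (rule Bochner_Integration.integral_cong[OF refl split])
  also have "\<dots> = expectation (\<lambda>x. J x * D l x) + expectation (\<lambda>x. J x * Q l x)"
    using JD intL intQ eL eQ by simp
  finally show ?eq
    using JD JQ by (simp add: distrib_left)
qed

lemma integrable_Y: "integrable M (Y l)"
proof (induction l)
  case 0
  have "integrable M (\<lambda>x. y\<^sub>0)" by simp
  then show ?case
    by (subst Bochner_Integration.integrable_cong[OF refl Y_0])
next
  case (Suc l)
  show ?case using one_step(1)[OF Suc, of "\<lambda>_. 1"] by simp
qed

lemma expectation_Y_le:
  assumes "0 \<le> a"
  shows "expectation (Y l) \<le> (1 + a) ^ l * y\<^sub>0"
proof (induction l)
  case 0
  have "expectation (Y 0) = expectation (\<lambda>x. y\<^sub>0)"
    by (rule Bochner_Integration.integral_cong[OF refl Y_0])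
  then show ?case by (simp add: prob_space)
next
  case (Suc l)
  have "expectation (Y (Suc l)) = expectation (\<lambda>x. D l x + Q l x)"
    using one_step(3)[OF integrable_Y, of "\<lambda>_. 1" l] by simp
  also have "\<dots> \<le> expectation (\<lambda>x. (1 + a) * Y l x)"
  proof (rule integral_mono)
    show "integrable M (\<lambda>x. D l x + Q l x)"
      using one_step(2)[OF integrable_Y, of "\<lambda>_. 1" l] by simp
    show "D l x + Q l x \<le> (1 + a) * Y l x" if "x \<in> space M" for x
      using drift[OF that, of l] by (simp add: algebra_simps)
  qed (simp add: integrable_Y)
  also have "\<dots> \<le> (1 + a) * ((1 + a) ^ l * y\<^sub>0)"
    using Suc assms by (simp add: mult_left_mono)
  finally show ?case by simp
qed

lemma measurable_exceed:
  "{x \<in> space M. \<exists>k\<le>l. t \<le> Y k x} \<in> sets (past M X l)"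
proof -
  have "{x \<in> space (past M X l). \<exists>k\<in>{..l}. t \<le> Y k x} \<in> sets (past M X l)"
    by (intro sets.sets_Collect_finite_Ex borel_measurable_le borel_measurable_const Y_adapted)
      auto
  then show ?thesis by (simp only: Bex_def atMost_iff space_past)
qed

text \<open>Doob's argument as an induction: on the part of \<open>A (l + 1)\<close> already in \<open>A l\<close>, passing from \<open>Y l\<close>
  to \<open>Y (l + 1)\<close> costs a factor \<open>1 - a\<close> in expectation because \<open>A l\<close> belongs to the past; on the
  new part \<open>Y (l + 1)\<close> is at least \<open>t\<close>.\<close>

lemma maximal_lower:
  assumes a: "0 \<le> a" "a \<le> 1" and t: "0 \<le> t"
  defines "A \<equiv> \<lambda>l. {x \<in> space M. \<exists>k\<le>l. t \<le> Y k x}"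
  shows "t * (1 - a) ^ l * prob (A l) \<le> expectation (\<lambda>x. indicator (A l) x * Y l x)"
proof -
  have A_past: "A l \<in> sets (past M X l)" for l
    unfolding A_def by (rule measurable_exceed)
  have ind_past: "indicat_real (A l) \<in> borel_measurable (past M X l)" for l
    using A_past by simp
  have A_ev [measurable]: "A l \<in> events" for l
    by (rule events_of_past[OF A_past])
  have int_ind: "integrable M (\<lambda>x. indicator (A k) x * Y l x)" for k l
    using integrable_real_mult_indicator[OF A_ev[of k] integrable_Y[of l]]
    by (simp add: mult.commute)
  have int_one: "integrable M (indicat_real (A l))" for l
    by (rule integrable_real_indicator[OF A_ev]) (simp add: less_top[symmetric])
  show ?thesis
  proof (induction l)
    case 0
    have "t * prob (A 0) = expectation (\<lambda>x. t * indicator (A 0) x)"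
      by simp
    also have "\<dots> \<le> expectation (\<lambda>x. indicator (A 0) x * Y 0 x)"
    proof (rule integral_mono)
      show "t * indicator (A 0) x \<le> indicator (A 0) x * Y 0 x" for x
        by (simp add: A_def split: split_indicator)
    qed (simp_all add: int_one int_ind)
    finally show ?case by simp
  next
    case (Suc l)
    have mono: "A l \<subseteq> A (Suc l)"
      by (auto simp: A_def intro: le_SucI)
    have "t * (1 - a) ^ Suc l * prob (A (Suc l)) =
        (1 - a) * (t * (1 - a) ^ l * prob (A l)) +
        t * (1 - a) ^ Suc l * (prob (A (Suc l)) - prob (A l))"
      by (simp add: algebra_simps)
    also have "\<dots> \<le> (1 - a) * expectation (\<lambda>x. indicator (A l) x * Y l x) +
        t * 1 * (prob (A (Suc l)) - prob (A l))"
    proof (rule add_mono)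
      show "(1 - a) * (t * (1 - a) ^ l * prob (A l))
          \<le> (1 - a) * expectation (\<lambda>x. indicator (A l) x * Y l x)"
        using a by (intro mult_left_mono Suc) auto
      have "prob (A l) \<le> prob (A (Suc l))"
        by (rule finite_measure_mono[OF mono A_ev])
      moreover have "(1 - a) ^ Suc l \<le> 1"
        using a by (intro power_le_one) auto
      ultimately show "t * (1 - a) ^ Suc l * (prob (A (Suc l)) - prob (A l))
          \<le> t * 1 * (prob (A (Suc l)) - prob (A l))"
        using t by (intro mult_right_mono mult_left_mono) auto
    qed
    also have "\<dots> = expectation (\<lambda>x. (1 - a) * (indicator (A l) x * Y l x)) +
        expectation (\<lambda>x. t * (indicator (A (Suc l)) x - indicator (A l) x))"
      by (simp add: int_one)
    also have "\<dots> \<le> expectation (\<lambda>x. indicator (A l) x * (D l x + Q l x)) +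
        expectation (\<lambda>x. (indicator (A (Suc l)) x - indicator (A l) x) * Y (Suc l) x)"
    proof (rule add_mono; rule integral_mono)
      show "integrable M (\<lambda>x. indicator (A l) x * (D l x + Q l x))"
        by (rule one_step(2)[OF integrable_Y]) (simp_all add: ind_past)
      show "integrable M (\<lambda>x. (indicator (A (Suc l)) x - indicator (A l) x) * Y (Suc l) x)"
        using int_ind by (simp add: left_diff_distrib)
      show "(1 - a) * (indicator (A l) x * Y l x) \<le> indicator (A l) x * (D l x + Q l x)"
        if "x \<in> space M" for x
        using drift[OF that, of l] by (auto simp: algebra_simps split: split_indicator)
      show "t * (indicator (A (Suc l)) x - indicator (A l) x)
          \<le> (indicator (A (Suc l)) x - indicator (A l) x) * Y (Suc l) x"
        if "x \<in> space M" for x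
        using mono that
        by (auto simp: A_def le_Suc_eq split: split_indicator)
    qed (simp_all add: int_ind int_one)
    also have "expectation (\<lambda>x. indicator (A l) x * (D l x + Q l x)) =
        expectation (\<lambda>x. indicator (A l) x * Y (Suc l) x)"
      by (rule one_step(3)[OF integrable_Y, symmetric]) (simp_all add: ind_past)
    also have "\<dots> + expectation (\<lambda>x. (indicator (A (Suc l)) x - indicator (A l) x) * Y (Suc l) x) =
        expectation (\<lambda>x. indicator (A (Suc l)) x * Y (Suc l) x)"
      using int_ind by (simp add: left_diff_distrib)
    finally show ?case .
  qed
qed

text \<open>The lower bound on \<open>Y n\<close> over the exceedance event meets the upper bound on its expectation.\<close>

lemma maximal_inequality:
  assumes a: "0 \<le> a" "a \<le> 1 / 2" and t: "0 < t" and y\<^sub>0: "0 \<le> y\<^sub>0"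
  shows "prob {x \<in> space M. \<exists>l\<le>n. t \<le> Y l x} \<le> exp (3 * (real n * a)) * y\<^sub>0 / t"
proof -
  let ?A = "{x \<in> space M. \<exists>l\<le>n. t \<le> Y l x}"
  have "t * (1 - a) ^ n * prob ?A \<le> expectation (\<lambda>x. indicator ?A x * Y n x)"
    using a t by (intro maximal_lower) auto
  also have "\<dots> \<le> expectation (Y n)"
  proof (rule integral_mono')
    show "indicator ?A x * Y n x \<le> Y n x" if "x \<in> space M" for x
      using Y_nonneg[OF that, of n] by (auto split: split_indicator)
  qed (simp_all add: integrable_Y Y_nonneg)
  also have "\<dots> \<le> (1 + a) ^ n * y\<^sub>0"
    by (rule expectation_Y_le[OF a(1)])
  finally have *: "t * (1 - a) ^ n * prob ?A \<le> (1 + a) ^ n * y\<^sub>0" .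
  \<comment> \<open>For \<open>a \<le> 1/2\<close> the factor \<open>(1 - a)^n\<close> can be inverted at the price of \<open>(1 + 2 * a)^n\<close>.\<close>
  have "1 \<le> (1 + 2 * a) * (1 - a)"
    using a mult_left_mono[of a "1/2" a] by (simp add: algebra_simps)
  then have "1 \<le> ((1 + 2 * a) * (1 - a)) ^ n"
    by (rule one_le_power)
  then have one: "1 \<le> (1 + 2 * a) ^ n * (1 - a) ^ n"
    by (simp add: power_mult_distrib)
  have "t * prob ?A * 1 \<le> t * prob ?A * ((1 + 2 * a) ^ n * (1 - a) ^ n)"
    using t by (intro mult_left_mono one) auto
  also have "\<dots> = (1 + 2 * a) ^ n * (t * (1 - a) ^ n * prob ?A)"
    by (simp add: algebra_simps)
  also have "\<dots> \<le> (1 + 2 * a) ^ n * ((1 + a) ^ n * y\<^sub>0)"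
    using a by (intro mult_left_mono *) auto
  also have "\<dots> \<le> exp (2 * a) ^ n * (exp a ^ n * y\<^sub>0)"
    using a y\<^sub>0 by (intro mult_mono power_mono mult_right_mono exp_ge_add_one_self) auto
  also have "\<dots> = exp (3 * (real n * a)) * y\<^sub>0"
  proof -
    have "exp (3 * (real n * a)) = exp (real n * (2 * a)) * exp (real n * a)"
      by (simp add: exp_add[symmetric])
    then show ?thesis
      by (simp only: exp_of_nat_mult mult.assoc)
  qed
  finally show ?thesis
    using t by (simp add: field_simps)
qed

end

section \<open>The energy of the transfer recursion\<close>

abbreviation shift :: "(nat \<Rightarrow> real) \<Rightarrow> nat \<Rightarrow> real" where
  "shift x \<equiv> case_nat 0 x"

text \<open>\<open>sol E d s a b l j\<close> is the coefficient of \<open>\<zeta> ^ j\<close> in the solution of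
  \<open>u\<^sub>l\<^sub>+\<^sub>1 = (E - s\<^sub>l + d \<zeta>) u\<^sub>l - u\<^sub>l\<^sub>-\<^sub>1\<close> with \<open>u\<^sub>0 = b\<close> and \<open>u\<^sub>1 = a\<close>; multiplication by \<open>\<zeta>\<close> is a shift of the
  coefficients.\<close>

fun sol :: "real \<Rightarrow> real \<Rightarrow> (nat \<Rightarrow> real) \<Rightarrow> real \<Rightarrow> real \<Rightarrow> nat \<Rightarrow> nat \<Rightarrow> real" where
  "sol E d s a b 0 = (\<lambda>j. if j = 0 then b else 0)"
| "sol E d s a b (Suc 0) = (\<lambda>j. if j = 0 then a else 0)"
| "sol E d s a b (Suc (Suc l)) = (\<lambda>j. (E - s (Suc l)) * sol E d s a b (Suc l) j
     + d * shift (sol E d s a b (Suc l)) j - sol E d s a b l j)"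

text \<open>The quadratic form invariant under \<open>(x, y) \<mapsto> (E x - y, x)\<close>.\<close>

definition form :: "real \<Rightarrow> real \<Rightarrow> real \<Rightarrow> real" where
  "form E x y = x\<^sup>2 - E * x * y + y\<^sup>2"

definition energy :: "real \<Rightarrow> nat \<Rightarrow> (nat \<Rightarrow> real) \<Rightarrow> (nat \<Rightarrow> real) \<Rightarrow> real" where
  "energy E N x y = (\<Sum>j\<le>N. form E (x j) (y j))"

definition total_energy :: "real \<Rightarrow> real \<Rightarrow> nat \<Rightarrow> (nat \<Rightarrow> real) \<Rightarrow> nat \<Rightarrow> real" where
  "total_energy E d N s l =
     (\<Sum>(a, b)\<in>{(1, 0), (0, 1)}. energy E N (sol E d s a b (Suc l)) (sol E d s a b l))"

text \<open>The energy after one step is a quadratic polynomial in the noise; the next three definitions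
  are its coefficients.\<close>

definition energy_const :: "real \<Rightarrow> real \<Rightarrow> nat \<Rightarrow> (nat \<Rightarrow> real) \<Rightarrow> (nat \<Rightarrow> real) \<Rightarrow> real" where
  "energy_const E d N x y =
     (\<Sum>j\<le>N. form E (x j) (y j) + 2 * d * shift x j * (E / 2 * x j - y j) + d\<^sup>2 * (shift x j)\<^sup>2)"

definition energy_lin :: "real \<Rightarrow> real \<Rightarrow> nat \<Rightarrow> (nat \<Rightarrow> real) \<Rightarrow> (nat \<Rightarrow> real) \<Rightarrow> real" where
  "energy_lin E d N x y =
     (\<Sum>j\<le>N. - 2 * x j * (E / 2 * x j - y j) - 2 * d * shift x j * x j)"

definition energy_quad :: "nat \<Rightarrow> (nat \<Rightarrow> real) \<Rightarrow> real" where
  "energy_quad N x = (\<Sum>j\<le>N. (x j)\<^sup>2)"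

lemma energy_step:
  "energy E N (\<lambda>j. (E - s) * x j + d * shift x j - y j) x =
     energy_const E d N x y + s * energy_lin E d N x y + s\<^sup>2 * energy_quad N x"
  unfolding energy_def energy_const_def energy_lin_def energy_quad_def
    sum_distrib_left sum.distrib[symmetric]
  by (rule sum.cong) (simp_all add: form_def power2_eq_square algebra_simps)

text \<open>By \<open>2 \<bar>x y\<bar> \<le> x\<^sup>2 + y\<^sup>2\<close>; for \<open>\<bar>E\<bar> < 2\<close> this is positive definiteness.\<close>

lemma form_lower: "(1 - \<bar>E\<bar> / 2) * (x\<^sup>2 + y\<^sup>2) \<le> form E x y"
proof -
  have "E * x * y \<le> \<bar>E\<bar> * \<bar>x * y\<bar>"
    by (metis abs_ge_self abs_mult mult.assoc)
  also have "\<dots> \<le> \<bar>E\<bar> * ((x\<^sup>2 + y\<^sup>2) / 2)"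
    using sum_squares_bound[of "\<bar>x\<bar>" "\<bar>y\<bar>"] by (intro mult_left_mono) (auto simp: abs_mult)
  finally show ?thesis
    by (simp add: form_def algebra_simps)
qed

lemma energy_lower: "(1 - \<bar>E\<bar> / 2) * (\<Sum>j\<le>N. (x j)\<^sup>2 + (y j)\<^sup>2) \<le> energy E N x y"
  unfolding energy_def sum_distrib_left by (intro sum_mono form_lower)

lemma sum_shift_le: "(\<Sum>j\<le>N. (shift x j)\<^sup>2) \<le> (\<Sum>j\<le>N. (x j)\<^sup>2)"
proof (cases N)
  case (Suc m)
  have "(\<Sum>j\<le>Suc m. (shift x j)\<^sup>2) = (\<Sum>j\<le>m. (x j)\<^sup>2)"
    by (simp add: sum.atMost_Suc_shift del: sum.atMost_Suc)
  then show ?thesis by (simp add: Suc)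
qed simp

lemma abs_2_mult_le: "\<bar>2 * p * q\<bar> \<le> p\<^sup>2 + (q::real)\<^sup>2"
  using sum_squares_bound[of "\<bar>p\<bar>" "\<bar>q\<bar>"] by (simp add: abs_mult)

lemma cross_le:
  fixes E x y :: real
  assumes "\<bar>E\<bar> \<le> 2"
  shows "(E / 2 * x - y)\<^sup>2 \<le> 2 * (x\<^sup>2 + y\<^sup>2)"
proof -
  have "(E / 2 * x - y)\<^sup>2 \<le> 2 * (E / 2 * x)\<^sup>2 + 2 * y\<^sup>2"
    using abs_2_mult_le[of "E / 2 * x" y] by (simp add: power2_diff)
  also have "(E / 2)\<^sup>2 \<le> 1"
    using assms by (simp add: abs_square_le_1)
  then have "2 * (E / 2 * x)\<^sup>2 \<le> 2 * (1 * x\<^sup>2)"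
    unfolding power_mult_distrib by (intro mult_left_mono mult_right_mono) auto
  finally show ?thesis by simp
qed

context
  fixes E d \<tau> :: real and N :: nat and x y :: "nat \<Rightarrow> real"
  assumes E: "\<bar>E\<bar> \<le> 2" and d: "0 \<le> d"
begin

lemma sum_squares_split_le:
  "(\<Sum>j\<le>N. (x j)\<^sup>2) \<le> (\<Sum>j\<le>N. (x j)\<^sup>2 + (y j)\<^sup>2)"
  by (intro sum_mono) simp

text \<open>The left-hand side is the drift of the energy under noise of variance \<open>\<tau>\<^sup>2\<close>. By invariance of
  \<open>form\<close> only terms with a factor \<open>d\<close> or \<open>\<tau>\<^sup>2\<close> survive; in the application both are of order \<open>1/n\<close>.\<close>

lemma energy_drift_bound:
  "\<bar>energy_const E d N x y + \<tau>\<^sup>2 * energy_quad N x - energy E N x y\<bar>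
     \<le> (3 * d + d\<^sup>2 + \<tau>\<^sup>2) * (\<Sum>j\<le>N. (x j)\<^sup>2 + (y j)\<^sup>2)"
proof -
  have eq: "energy_const E d N x y + \<tau>\<^sup>2 * energy_quad N x - energy E N x y =
      (\<Sum>j\<le>N. d * (2 * shift x j * (E / 2 * x j - y j)) + d\<^sup>2 * (shift x j)\<^sup>2 + \<tau>\<^sup>2 * (x j)\<^sup>2)"
    unfolding energy_const_def energy_quad_def energy_def sum_distrib_left
      sum.distrib[symmetric] sum_subtractf[symmetric]
    by (rule sum.cong) (simp_all add: algebra_simps)
  have "\<bar>energy_const E d N x y + \<tau>\<^sup>2 * energy_quad N x - energy E N x y\<bar> \<le>
      (\<Sum>j\<le>N. \<bar>d * (2 * shift x j * (E / 2 * x j - y j)) + d\<^sup>2 * (shift x j)\<^sup>2 + \<tau>\<^sup>2 * (x j)\<^sup>2\<bar>)"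
    unfolding eq by (rule sum_abs)
  also have "\<dots> \<le> (\<Sum>j\<le>N. (d + d\<^sup>2) * (shift x j)\<^sup>2 + \<tau>\<^sup>2 * (x j)\<^sup>2 + 2 * d * ((x j)\<^sup>2 + (y j)\<^sup>2))"
  proof (rule sum_mono)
    fix j
    have "\<bar>d * (2 * shift x j * (E / 2 * x j - y j))\<bar> = d * \<bar>2 * shift x j * (E / 2 * x j - y j)\<bar>"
      using d by (simp add: abs_mult)
    also have "\<dots> \<le> d * ((shift x j)\<^sup>2 + 2 * ((x j)\<^sup>2 + (y j)\<^sup>2))"
      using abs_2_mult_le[of "shift x j" "E / 2 * x j - y j"] cross_le[OF E, of "x j" "y j"] d
      by (intro mult_left_mono) auto
    finally have "\<bar>d * (2 * shift x j * (E / 2 * x j - y j))\<bar>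
      \<le> d * (shift x j)\<^sup>2 + 2 * d * ((x j)\<^sup>2 + (y j)\<^sup>2)"
      by (simp only: distrib_left mult.assoc mult.left_commute[of d 2])
    moreover have "0 \<le> d\<^sup>2 * (shift x j)\<^sup>2" "0 \<le> \<tau>\<^sup>2 * (x j)\<^sup>2"
      by simp_all
    ultimately show "\<bar>d * (2 * shift x j * (E / 2 * x j - y j)) + d\<^sup>2 * (shift x j)\<^sup>2 + \<tau>\<^sup>2 * (x j)\<^sup>2\<bar>
        \<le> (d + d\<^sup>2) * (shift x j)\<^sup>2 + \<tau>\<^sup>2 * (x j)\<^sup>2 + 2 * d * ((x j)\<^sup>2 + (y j)\<^sup>2)"
      unfolding distrib_right[of d "d\<^sup>2"] by linarith
  qed
  also have "\<dots> = (d + d\<^sup>2) * (\<Sum>j\<le>N. (shift x j)\<^sup>2) + \<tau>\<^sup>2 * (\<Sum>j\<le>N. (x j)\<^sup>2)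
      + 2 * d * (\<Sum>j\<le>N. (x j)\<^sup>2 + (y j)\<^sup>2)"
    by (simp only: sum.distrib sum_distrib_left[symmetric])
  also have "\<dots> \<le> (d + d\<^sup>2) * (\<Sum>j\<le>N. (x j)\<^sup>2 + (y j)\<^sup>2) + \<tau>\<^sup>2 * (\<Sum>j\<le>N. (x j)\<^sup>2 + (y j)\<^sup>2)
      + 2 * d * (\<Sum>j\<le>N. (x j)\<^sup>2 + (y j)\<^sup>2)"
    using d sum_squares_split_le sum_shift_le[of x N]
    by (intro add_mono mult_left_mono) auto
  also have "\<dots> = (3 * d + d\<^sup>2 + \<tau>\<^sup>2) * (\<Sum>j\<le>N. (x j)\<^sup>2 + (y j)\<^sup>2)"
    unfolding distrib_right by simp
  finally show ?thesis .
qed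

lemma energy_lin_bound:
  "\<bar>energy_lin E d N x y\<bar> \<le> (3 + 2 * d) * (\<Sum>j\<le>N. (x j)\<^sup>2 + (y j)\<^sup>2)"
proof -
  have "\<bar>energy_lin E d N x y\<bar> \<le>
      (\<Sum>j\<le>N. \<bar>- 2 * x j * (E / 2 * x j - y j) - 2 * d * shift x j * x j\<bar>)"
    unfolding energy_lin_def by (rule sum_abs)
  also have "\<dots> \<le> (\<Sum>j\<le>N. d * (shift x j)\<^sup>2 + d * (x j)\<^sup>2 + 3 * ((x j)\<^sup>2 + (y j)\<^sup>2))"
  proof (rule sum_mono)
    fix j
    have "\<bar>d * (2 * shift x j * x j)\<bar> = d * \<bar>2 * shift x j * x j\<bar>"
      using d by (simp add: abs_mult)
    also have "\<dots> \<le> d * ((shift x j)\<^sup>2 + (x j)\<^sup>2)"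
      using abs_2_mult_le d by (intro mult_left_mono) auto
    finally have 1: "\<bar>d * (2 * shift x j * x j)\<bar> \<le> d * (shift x j)\<^sup>2 + d * (x j)\<^sup>2"
      by (simp add: distrib_left)
    have 2: "\<bar>2 * x j * (E / 2 * x j - y j)\<bar> \<le> 3 * ((x j)\<^sup>2 + (y j)\<^sup>2)"
    proof -
      have "\<bar>2 * x j * (E / 2 * x j - y j)\<bar> \<le> (x j)\<^sup>2 + (E / 2 * x j - y j)\<^sup>2"
        by (rule abs_2_mult_le)
      also have "\<dots> \<le> (x j)\<^sup>2 + 2 * ((x j)\<^sup>2 + (y j)\<^sup>2)"
        by (intro add_left_mono cross_le E)
      also have "\<dots> \<le> 3 * ((x j)\<^sup>2 + (y j)\<^sup>2)"
        by simp
      finally show ?thesis .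
    qed
    have "\<bar>- 2 * x j * (E / 2 * x j - y j) - 2 * d * shift x j * x j\<bar> =
        \<bar>2 * x j * (E / 2 * x j - y j) + d * (2 * shift x j * x j)\<bar>"
      by (subst abs_minus_cancel[symmetric]) (simp add: algebra_simps)
    with 1 2 show "\<bar>- 2 * x j * (E / 2 * x j - y j) - 2 * d * shift x j * x j\<bar>
        \<le> d * (shift x j)\<^sup>2 + d * (x j)\<^sup>2 + 3 * ((x j)\<^sup>2 + (y j)\<^sup>2)"
      by linarith
  qed
  also have "\<dots> = d * (\<Sum>j\<le>N. (shift x j)\<^sup>2) + d * (\<Sum>j\<le>N. (x j)\<^sup>2)
      + 3 * (\<Sum>j\<le>N. (x j)\<^sup>2 + (y j)\<^sup>2)"
    by (simp only: sum.distrib sum_distrib_left[symmetric])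
  also have "\<dots> \<le> d * (\<Sum>j\<le>N. (x j)\<^sup>2 + (y j)\<^sup>2) + d * (\<Sum>j\<le>N. (x j)\<^sup>2 + (y j)\<^sup>2)
      + 3 * (\<Sum>j\<le>N. (x j)\<^sup>2 + (y j)\<^sup>2)"
    using d sum_squares_split_le sum_shift_le[of x N]
    by (intro add_mono mult_left_mono) auto
  also have "\<dots> = (3 + 2 * d) * (\<Sum>j\<le>N. (x j)\<^sup>2 + (y j)\<^sup>2)"
    unfolding distrib_right by simp
  finally show ?thesis .
qed

lemma energy_quad_bound: "\<bar>energy_quad N x\<bar> \<le> (\<Sum>j\<le>N. (x j)\<^sup>2 + (y j)\<^sup>2)"
  using sum_squares_split_le by (simp add: energy_quad_def sum_nonneg)

end

section \<open>Transfer matrices as polynomials in the spectral parameter\<close>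

definition peval :: "nat \<Rightarrow> (nat \<Rightarrow> real) \<Rightarrow> complex \<Rightarrow> complex" where
  "peval N p z = (\<Sum>j\<le>N. complex_of_real (p j) * z ^ j)"

text \<open>The vanishing top coefficient is what makes truncation at \<open>N\<close> harmless.\<close>

lemma peval_shift:
  assumes "p N = 0"
  shows "peval N (shift p) z = z * peval N p z"
proof (cases N)
  case 0
  then show ?thesis using assms by (simp add: peval_def)
next
  case (Suc m)
  have "peval (Suc m) (shift p) z = (\<Sum>j\<le>m. z * (complex_of_real (p j) * z ^ j))"
    by (simp add: peval_def sum.atMost_Suc_shift ac_simps del: sum.atMost_Suc)
  also have "\<dots> = z * peval N p z"
    using assms by (simp add: peval_def Suc sum_distrib_left)
  finally show ?thesis by (simp add: Suc)
qed

lemma sol_eq_0: "l \<le> j \<Longrightarrow> 0 < j \<Longrightarrow> sol E d s a b l j = 0"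
  by (induction E d s a b l arbitrary: j rule: sol.induct) (auto split: nat.split)

lemma peval_sol_Suc:
  assumes "Suc l \<le> N"
  shows "peval N (sol E d s a b (Suc (Suc l))) z =
    (of_real (E - s (Suc l)) + of_real d * z) * peval N (sol E d s a b (Suc l)) z
      - peval N (sol E d s a b l) z"
proof -
  have "peval N (sol E d s a b (Suc (Suc l))) z =
    of_real (E - s (Suc l)) * peval N (sol E d s a b (Suc l)) z
      + of_real d * peval N (shift (sol E d s a b (Suc l))) z - peval N (sol E d s a b l) z"
    unfolding peval_def sum_distrib_left sum.distrib[symmetric] sum_subtractf[symmetric]
    by (rule sum.cong) (simp_all add: algebra_simps)
  also have "peval N (shift (sol E d s a b (Suc l))) z = z * peval N (sol E d s a b (Suc l)) z"
    by (rule peval_shift, rule sol_eq_0) (use assms in auto)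
  finally show ?thesis by (simp add: algebra_simps)
qed

lemma peval_0 [simp]: "peval N (\<lambda>j. 0) z = 0"
  by (simp add: peval_def)

lemma peval_const: "peval N (\<lambda>j. if j = 0 then c else 0) z = of_real c"
proof -
  have "peval N (\<lambda>j. if j = 0 then c else 0) z = (\<Sum>j\<le>N. if j = 0 then of_real c else 0)"
    unfolding peval_def by (rule sum.cong) auto
  then show ?thesis by (simp add: sum.delta)
qed

text \<open>Cauchy-Schwarz against the geometric series \<open>\<Sum>\<^sub>j 4\<^sup>-\<^sup>j = 4 / 3\<close>. This replaces the supremum over a
  disc by a quantity in which \<open>z\<close> does not occur; it is the reason for measuring \<open>z\<close> in units of
  twice the radius.\<close>

lemma cmod_peval_le:
  assumes "cmod z \<le> 1 / 2"
  shows "(cmod (peval N p z))\<^sup>2 \<le> 4 / 3 * (\<Sum>j\<le>N. (p j)\<^sup>2)"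
proof -
  have "cmod (peval N p z) \<le> (\<Sum>j\<le>N. cmod (complex_of_real (p j) * z ^ j))"
    unfolding peval_def by (rule norm_sum)
  also have "\<dots> \<le> (\<Sum>j\<le>N. \<bar>p j\<bar> * (1 / 2) ^ j)"
    using assms by (intro sum_mono) (auto simp: norm_mult norm_power intro!: mult_left_mono power_mono)
  finally have "(cmod (peval N p z))\<^sup>2 \<le> (\<Sum>j\<le>N. \<bar>p j\<bar> * (1 / 2) ^ j)\<^sup>2"
    by (intro power_mono) auto
  also have "\<dots> \<le> (\<Sum>j\<le>N. \<bar>p j\<bar>\<^sup>2) * (\<Sum>j\<le>N. ((1 / 2) ^ j)\<^sup>2)"
    by (rule Cauchy_Schwarz_ineq_sum)
  also have "(\<Sum>j\<le>N. ((1 / 2 :: real) ^ j)\<^sup>2) = 4 / 3 - 1 / 3 * (1 / 4) ^ N"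
  proof -
    have "((1 / 2 :: real) ^ j)\<^sup>2 = (1 / 4) ^ j" for j
      by (simp add: power2_eq_square flip: power_mult_distrib)
    then have "(\<Sum>j\<le>N. ((1 / 2 :: real) ^ j)\<^sup>2) = (\<Sum>j\<le>N. (1 / 4) ^ j)"
      by (rule sum.cong[OF refl])
    also have "\<dots> = 4 / 3 - 1 / 3 * (1 / 4) ^ N"
      by (induction N) simp_all
    finally show ?thesis .
  qed
  also have "(\<Sum>j\<le>N. \<bar>p j\<bar>\<^sup>2) * (4 / 3 - 1 / 3 * (1 / 4) ^ N) \<le> (\<Sum>j\<le>N. \<bar>p j\<bar>\<^sup>2) * (4 / 3)"
    by (intro mult_left_mono) (auto intro: sum_nonneg)
  finally show ?thesis by (simp add: mult.commute)
qed

lemma T_mult: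
  "(T x ** A) $ 1 $ j = x * A $ 1 $ j - A $ 2 $ j"
  "(T x ** A) $ 2 $ j = A $ 1 $ j"
  by (simp_all add: T_def matrix_matrix_mult_def sum_2)

lemma tr_AAstar_eq:
  "tr_AAstar A = (cmod (A $ 1 $ 1))\<^sup>2 + (cmod (A $ 1 $ 2))\<^sup>2 + (cmod (A $ 2 $ 1))\<^sup>2 + (cmod (A $ 2 $ 2))\<^sup>2"
  by (simp add: tr_AAstar_def trace_def conj_transpose_def map_matrix_def matrix_matrix_mult_def
      sum_2 Finite_Cartesian_Product.transpose_def complex_mult_cnj cmod_power2)

text \<open>Each column of the transfer matrix consists of two consecutive values of a solution; the columns
  differ in the initial values \<open>(1, 0)\<close> and \<open>(0, 1)\<close>. Here \<open>\<zeta> = z / (2 R)\<close>.\<close>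

lemma transfer_eq_peval:
  fixes E R \<sigma> :: real and w :: "nat \<Rightarrow> real" and z :: complex
  assumes R: "0 < R" and l: "l \<le> n"
  defines "P \<equiv> \<lambda>a b k. peval n
    (sol E (2 * R / (rho E * real n)) (\<lambda>k. \<sigma> / sqrt (real n) * w k) a b k) (z / of_real (2 * R))"
  shows "transfer E \<sigma> n w z l $ 1 $ 1 = P 1 0 (Suc l)" "transfer E \<sigma> n w z l $ 2 $ 1 = P 1 0 l"
    "transfer E \<sigma> n w z l $ 1 $ 2 = P 0 1 (Suc l)" "transfer E \<sigma> n w z l $ 2 $ 2 = P 0 1 l"
proof -
  have "transfer E \<sigma> n w z l $ 1 $ 1 = P 1 0 (Suc l) \<and> transfer E \<sigma> n w z l $ 2 $ 1 = P 1 0 l \<and>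
    transfer E \<sigma> n w z l $ 1 $ 2 = P 0 1 (Suc l) \<and> transfer E \<sigma> n w z l $ 2 $ 2 = P 0 1 l"
    using l
  proof (induction l)
    case 0
    show ?case by (simp add: P_def peval_const Finite_Cartesian_Product.mat_def)
  next
    case (Suc l)
    have "complex_of_real E + eps E \<sigma> n w z (Suc l) =
      of_real (E - \<sigma> / sqrt (real n) * w (Suc l))
        + of_real (2 * R / (rho E * real n)) * (z / of_real (2 * R))"
      using R by (simp add: eps_def)
    then have "P a b (Suc (Suc l)) =
        (complex_of_real E + eps E \<sigma> n w z (Suc l)) * P a b (Suc l) - P a b l" for a b
      unfolding P_def using Suc.prems by (subst peval_sol_Suc) simp_all
    then show ?case using Suc by (simp add: T_mult)
  qed
  then show "transfer E \<sigma> n w z l $ 1 $ 1 = P 1 0 (Suc l)" "transfer E \<sigma> n w z l $ 2 $ 1 = P 1 0 l"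
    "transfer E \<sigma> n w z l $ 1 $ 2 = P 0 1 (Suc l)" "transfer E \<sigma> n w z l $ 2 $ 2 = P 0 1 l"
    by auto
qed

lemma tr_transfer_eq_peval:
  fixes E R \<sigma> :: real and w :: "nat \<Rightarrow> real" and z :: complex
  assumes R: "0 < R" and l: "l \<le> n"
  defines "u \<equiv> sol E (2 * R / (rho E * real n)) (\<lambda>k. \<sigma> / sqrt (real n) * w k)"
  shows "tr_AAstar (transfer E \<sigma> n w z l) =
    (\<Sum>(a, b)\<in>{(1, 0), (0, 1)}. (cmod (peval n (u a b (Suc l)) (z / of_real (2 * R))))\<^sup>2
      + (cmod (peval n (u a b l) (z / of_real (2 * R))))\<^sup>2)"
  unfolding tr_AAstar_eq u_def transfer_eq_peval[OF R l] by simp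

lemma tr_transfer_le_energy:
  fixes E R \<sigma> :: real and w :: "nat \<Rightarrow> real" and z :: complex
  assumes E: "\<bar>E\<bar> < 2" and R: "0 < R" and l: "l \<le> n" and z: "cmod z \<le> R"
  shows "tr_AAstar (transfer E \<sigma> n w z l) \<le>
    4 / (3 * (1 - \<bar>E\<bar> / 2)) * total_energy E (2 * R / (rho E * real n)) n (\<lambda>k. \<sigma> / sqrt (real n) * w k) l"
proof -
  have z': "cmod (z / of_real (2 * R)) \<le> 1 / 2"
    using z R by (simp add: norm_divide field_simps)
  have *: "(cmod (peval n x (z / of_real (2 * R))))\<^sup>2 + (cmod (peval n y (z / of_real (2 * R))))\<^sup>2
      \<le> 4 / (3 * (1 - \<bar>E\<bar> / 2)) * energy E n x y" for x y
  proof -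
    have "(cmod (peval n x (z / of_real (2 * R))))\<^sup>2 + (cmod (peval n y (z / of_real (2 * R))))\<^sup>2
      \<le> 4 / 3 * (\<Sum>j\<le>n. (x j)\<^sup>2 + (y j)\<^sup>2)"
      using cmod_peval_le[OF z', of n x] cmod_peval_le[OF z', of n y]
      by (simp only: sum.distrib distrib_left)
    also have "\<dots> \<le> 4 / 3 * (energy E n x y / (1 - \<bar>E\<bar> / 2))"
      using energy_lower[where E = E and N = n and x = x and y = y] E by (intro mult_left_mono) (simp_all add: field_simps)
    finally show ?thesis by simp
  qed
  show ?thesis
    unfolding tr_transfer_eq_peval[OF R l] total_energy_def sum_distrib_left
    by (intro sum_mono) (use * in auto)
qed

section \<open>Delocalization from bounded transfer matrices\<close>

lemma det_transfer:
  "transfer E \<sigma> n w z l $ 1 $ 1 * transfer E \<sigma> n w z l $ 2 $ 2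
     - transfer E \<sigma> n w z l $ 1 $ 2 * transfer E \<sigma> n w z l $ 2 $ 1 = 1"
proof (induction l)
  case (Suc l)
  then show ?case by (simp add: T_mult algebra_simps)
qed (simp add: Finite_Cartesian_Product.mat_def)

lemma cmod_det2_le:
  fixes a b c d :: complex
  shows "(cmod (a * d - b * c))\<^sup>2 \<le>
    ((cmod a)\<^sup>2 + (cmod c)\<^sup>2) * ((cmod b)\<^sup>2 + (cmod d)\<^sup>2)"
proof -
  have "cmod (a * d - b * c) \<le> cmod a * cmod d + cmod b * cmod c"
    using norm_triangle_ineq4[of "a * d" "b * c"] by (simp add: norm_mult)
  then have "(cmod (a * d - b * c))\<^sup>2 \<le> (cmod a * cmod d + cmod b * cmod c)\<^sup>2"
    by (intro power_mono) auto
  also have "\<dots> = ((cmod a)\<^sup>2 + (cmod c)\<^sup>2) * ((cmod b)\<^sup>2 + (cmod d)\<^sup>2)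
      - (cmod a * cmod b - cmod c * cmod d)\<^sup>2"
    by (simp add: power2_eq_square algebra_simps)
  finally show ?thesis by (rule order_trans) simp
qed

text \<open>The squared norms \<open>q\<close>, \<open>q'\<close> of the two columns satisfy \<open>q + q' < t\<close> and, by Hadamard's inequality
  for the determinant, \<open>q * q' \<ge> 1\<close>.\<close>

lemma first_column_bounds:
  fixes A :: "complex^2^2"
  assumes det: "A $ 1 $ 1 * A $ 2 $ 2 - A $ 1 $ 2 * A $ 2 $ 1 = 1" and t: "tr_AAstar A < t"
  defines "q \<equiv> (cmod (A $ 1 $ 1))\<^sup>2 + (cmod (A $ 2 $ 1))\<^sup>2"
  shows "q < t" and "1 < t * q"
proof -
  define q' where "q' = (cmod (A $ 1 $ 2))\<^sup>2 + (cmod (A $ 2 $ 2))\<^sup>2"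
  have tr: "q + q' < t"
    using t by (simp add: tr_AAstar_eq q_def q'_def)
  have nonneg: "0 \<le> q" "0 \<le> q'"
    by (simp_all add: q_def q'_def)
  have one: "1 \<le> q * q'"
    using cmod_det2_le[of "A $ 1 $ 1" "A $ 2 $ 2" "A $ 1 $ 2" "A $ 2 $ 1"]
    by (simp add: det q_def q'_def)
  show "q < t" using tr nonneg by simp
  have "q \<noteq> 0"
    using one by (metis mult_zero_left not_one_le_zero)
  then have "q * q' < q * t"
    using nonneg tr by (intro mult_strict_left_mono) auto
  then show "1 < t * q"
    using one by (simp add: mult.commute)
qed

lemma eigenvector_recursion:
  assumes ev: "eigenvector (H \<sigma> n w) \<psi> k" and i: "i < n"
  shows "coord n \<psi> (Suc (Suc i)) =
    (k - complex_of_real (\<sigma> * w (Suc i) / sqrt (real n))) * coord n \<psi> (Suc i) - coord n \<psi> i"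
proof -
  let ?v = "complex_of_real (\<sigma> * w (Suc i) / sqrt (real n))"
  have \<psi>: "dim_vec \<psi> = n" and eq: "H \<sigma> n w *\<^sub>v \<psi> = k \<cdot>\<^sub>v \<psi>"
    using ev by (auto simp: eigenvector_def H_def)
  have "vec_index (H \<sigma> n w *\<^sub>v \<psi>) i = (\<Sum>j\<in>{0..<n}. H \<sigma> n w $$ (i, j) * vec_index \<psi> j)"
    using i \<psi> by (simp add: H_def scalar_prod_def)
  also have "\<dots> = (\<Sum>j\<in>{0..<n}. (if j = i then ?v * vec_index \<psi> i else 0)
      + (if j = Suc i then vec_index \<psi> (Suc i) else 0)
      + (if j = i - 1 then (if 0 < i then vec_index \<psi> (i - 1) else 0) else 0))"
    using i by (intro sum.cong) (auto simp: H_def)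
  also have "\<dots> = ?v * vec_index \<psi> i + (if Suc i < n then vec_index \<psi> (Suc i) else 0)
      + (if 0 < i then vec_index \<psi> (i - 1) else 0)"
    using i by (simp add: sum.distrib)
  finally have "k * vec_index \<psi> i = ?v * vec_index \<psi> i
      + (if Suc i < n then vec_index \<psi> (Suc i) else 0)
      + (if 0 < i then vec_index \<psi> (i - 1) else 0)"
    using eq i \<psi> by simp
  moreover have "coord n \<psi> (Suc i) = vec_index \<psi> i"
    and "coord n \<psi> (Suc (Suc i)) = (if Suc i < n then vec_index \<psi> (Suc i) else 0)"
    and "coord n \<psi> i = (if 0 < i then vec_index \<psi> (i - 1) else 0)"
    using i by (auto simp: coord_def)
  ultimately show ?thesis
    by (simp add: algebra_simps)
qed

text \<open>The boundary value \<open>coord n \<psi> 0 = 0\<close> makes \<open>\<psi>\<close> a multiple of the first column.\<close>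

lemma eigenvector_eq_transfer:
  assumes ev: "eigenvector (H \<sigma> n w) \<psi> k"
    and k: "k = complex_of_real E + z / complex_of_real (rho E * real n)" and l: "l \<le> n"
  shows "coord n \<psi> (Suc l) = transfer E \<sigma> n w z l $ 1 $ 1 * coord n \<psi> 1"
    and "coord n \<psi> l = transfer E \<sigma> n w z l $ 2 $ 1 * coord n \<psi> 1"
proof -
  have "coord n \<psi> (Suc l) = transfer E \<sigma> n w z l $ 1 $ 1 * coord n \<psi> 1 \<and>
    coord n \<psi> l = transfer E \<sigma> n w z l $ 2 $ 1 * coord n \<psi> 1"
    using l
  proof (induction l)
    case 0
    show ?case by (simp add: Finite_Cartesian_Product.mat_def coord_def)
  next
    case (Suc l)
    then show ?case
      using eigenvector_recursion[OF ev, of l]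
      by (simp add: T_mult eps_def k algebra_simps)
  qed
  then show "coord n \<psi> (Suc l) = transfer E \<sigma> n w z l $ 1 $ 1 * coord n \<psi> 1"
    and "coord n \<psi> l = transfer E \<sigma> n w z l $ 2 $ 1 * coord n \<psi> 1"
    by auto
qed

lemma rho_ge_1: "\<bar>E\<bar> < 2 \<Longrightarrow> 1 \<le> rho E"
proof -
  assume "\<bar>E\<bar> < 2"
  then have "E\<^sup>2 < 4"
    using power_strict_mono[of "\<bar>E\<bar>" 2 2] by simp
  then show ?thesis
    by (simp add: rho_def)
qed

text \<open>With \<open>g l = \<bar>\<psi>\<^sub>l\<bar>\<^sup>2 + \<bar>\<psi>\<^sub>l\<^sub>+\<^sub>1\<bar>\<^sup>2 = q l * \<bar>\<psi>\<^sub>1\<bar>\<^sup>2\<close> and \<open>1/t < q l < t\<close>, all the \<open>g l\<close> agree up to a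
  factor \<open>t\<^sup>2\<close>. Every \<open>\<bar>\<psi>\<^sub>l\<bar>\<^sup>2\<close> occurs in exactly two of them, so their mean is \<open>2 / (n + 1)\<close>.\<close>

lemma delocalized_if_transfer_bounded:
  assumes E: "\<bar>E\<bar> < 2" and n: "0 < n" and bounded: "transfer_bounded E R \<sigma> n w t"
  shows "eigenvectors_delocalized E R \<sigma> n w t"
  unfolding eigenvectors_delocalized_def
proof (intro allI impI)
  fix \<psi> :: "complex Matrix.vec" and \<mu> :: real and l
  assume ev: "eigenvector (H \<sigma> n w) \<psi> (complex_of_real \<mu>)"
    and norm: "(\<Sum>l=1..n. (cmod (coord n \<psi> l))\<^sup>2) = 1"
    and \<mu>: "\<mu> \<in> {E - R / (rho E * real n)..E + R / (rho E * real n)}" and l: "l \<le> n"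
  have \<rho>n: "0 < rho E * real n"
    using rho_ge_1[OF E] n by simp
  define z where "z = complex_of_real ((\<mu> - E) * (rho E * real n))"
  have k: "complex_of_real \<mu> = complex_of_real E + z / complex_of_real (rho E * real n)"
    using \<rho>n by (auto simp: z_def)
  have "\<bar>\<mu> - E\<bar> \<le> R / (rho E * real n)"
    using \<mu> by auto
  then have z: "cmod z \<le> R"
    using \<rho>n unfolding z_def norm_of_real abs_mult[of "\<mu> - E"]
    by (simp add: abs_of_pos pos_le_divide_eq)
  define g where "g l = (cmod (coord n \<psi> l))\<^sup>2 + (cmod (coord n \<psi> (Suc l)))\<^sup>2" for l
  define q where "q l = (cmod (transfer E \<sigma> n w z l $ 1 $ 1))\<^sup>2
    + (cmod (transfer E \<sigma> n w z l $ 2 $ 1))\<^sup>2" for l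
  define g1 where "g1 = (cmod (coord n \<psi> 1))\<^sup>2"
  have g_eq: "g m = q m * g1" if "m \<le> n" for m
    unfolding g_def q_def g1_def eigenvector_eq_transfer[OF ev k that]
    by (simp add: norm_mult power_mult_distrib algebra_simps)
  have q: "q m < t" "1 < t * q m" if "m \<le> n" for m
    using bounded that z first_column_bounds[OF det_transfer]
    unfolding transfer_bounded_def q_def by blast+
  have t: "0 < t"
    using q(1)[of 0] by (simp add: q_def) (smt (verit) zero_le_power2)
  have sum_g: "(\<Sum>m\<le>n. g m) = 2"
  proof -
    have c0: "coord n \<psi> 0 = 0" "coord n \<psi> (Suc n) = 0"
      by (simp_all add: coord_def)
    have 1: "(\<Sum>m\<le>n. (cmod (coord n \<psi> m))\<^sup>2) = 1"
      unfolding norm[symmetric]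
      by (rule sum.mono_neutral_right) (auto simp: c0 not_le)
    have "(\<Sum>m\<le>Suc n. (cmod (coord n \<psi> m))\<^sup>2) = (\<Sum>m\<le>n. (cmod (coord n \<psi> (Suc m)))\<^sup>2)"
      by (subst sum.atMost_Suc_shift) (simp add: c0)
    then have 2: "(\<Sum>m\<le>n. (cmod (coord n \<psi> (Suc m)))\<^sup>2) = 1"
      using 1 by (simp add: c0)
    show ?thesis
      unfolding g_def sum.distrib using 1 2 by simp
  qed
  have "g1 \<noteq> 0"
  proof
    assume "g1 = 0"
    then have "(\<Sum>m\<le>n. g m) = 0"
      using g_eq by simp
    then show False using sum_g by simp
  qed
  then have g1: "0 < g1"
    by (simp add: g1_def)
  have less: "g a < t\<^sup>2 * g b" if "a \<le> n" "b \<le> n" for a b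
  proof -
    have "q a * 1 < t * (t * q b)"
      using q[OF that(1)] q[OF that(2)] t by (intro mult_strict_mono) (auto simp: q_def)
    then have "q a * g1 < (t\<^sup>2 * q b) * g1"
      using g1 by (intro mult_strict_right_mono) (simp_all add: power2_eq_square mult.assoc)
    then show ?thesis
      using that by (simp add: g_eq mult.assoc)
  qed
  have "(\<Sum>m\<le>n. g m) < (\<Sum>m\<le>n. t\<^sup>2 * g l)"
    by (rule sum_strict_mono) (use less l in auto)
  then have lower: "2 < (real n + 1) * (t\<^sup>2 * g l)"
    using sum_g by (simp add: add.commute)
  have "(\<Sum>m\<le>n. g l) < (\<Sum>m\<le>n. t\<^sup>2 * g m)"
    by (rule sum_strict_mono) (use less l in auto)
  then have upper: "(real n + 1) * g l < t\<^sup>2 * 2"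
    using sum_g by (simp add: add.commute flip: sum_distrib_left)
  have "2 / ((real n + 1) * t\<^sup>2) < g l"
    using lower t by (simp add: divide_less_eq mult_ac)
  moreover have "g l < 2 * t\<^sup>2 / (real n + 1)"
    using upper by (simp add: less_divide_eq mult_ac)
  ultimately show "2 / ((real n + 1) * t\<^sup>2)
        < (cmod (coord n \<psi> l))\<^sup>2 + (cmod (coord n \<psi> (l + 1)))\<^sup>2 \<and>
      (cmod (coord n \<psi> l))\<^sup>2 + (cmod (coord n \<psi> (l + 1)))\<^sup>2 < 2 * t\<^sup>2 / (real n + 1)"
    by (simp add: g_def)
qed


section \<open>Measurability of the event\<close>

text \<open>By compactness the strict inequality holds with a margin \<open>1 / (k + 1)\<close>, and by continuity the
  resulting non-strict inequality need only be tested on a countable dense subset.\<close>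

lemma sets_forall_less_compact:
  fixes f :: "'a \<Rightarrow> 'b::{metric_space, second_countable_topology} \<Rightarrow> real"
  assumes S: "compact S"
    and cont: "\<And>x. x \<in> space M \<Longrightarrow> continuous_on S (f x)"
    and meas: "\<And>z. z \<in> S \<Longrightarrow> (\<lambda>x. f x z) \<in> borel_measurable M"
  shows "{x \<in> space M. \<forall>z\<in>S. f x z < t} \<in> sets M"
proof -
  obtain D where D: "countable D" "D \<subseteq> S" "S \<subseteq> closure D"
    by (rule separable)
  have "(\<forall>z\<in>S. f x z < t) \<longleftrightarrow> (\<exists>k. \<forall>z\<in>D. f x z \<le> t - inverse (real (Suc k)))"
    if x: "x \<in> space M" for x
  proof
    assume lt: "\<forall>z\<in>S. f x z < t"
    show "\<exists>k. \<forall>z\<in>D. f x z \<le> t - inverse (real (Suc k))"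
    proof (cases "S = {}")
      case False
      obtain m where m: "m \<in> S" "\<And>z. z \<in> S \<Longrightarrow> f x z \<le> f x m"
        using continuous_attains_sup[OF S False cont[OF x]] by blast
      obtain k where "inverse (real (Suc k)) < t - f x m"
        using reals_Archimedean[of "t - f x m"] lt m(1) by auto
      then have "\<forall>z\<in>D. f x z \<le> t - inverse (real (Suc k))"
        using m D(2) by fastforce
      then show ?thesis ..
    qed (use D in auto)
  next
    assume "\<exists>k. \<forall>z\<in>D. f x z \<le> t - inverse (real (Suc k))"
    then obtain k where k: "\<And>z. z \<in> D \<Longrightarrow> f x z \<le> t - inverse (real (Suc k))"
      by blast
    have "closedin (top_of_set S) {z \<in> S. f x z \<le> t - inverse (real (Suc k))}"
      using continuous_closedin_preimage[OF cont[OF x], of "{..t - inverse (real (Suc k))}"]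
      by (simp add: vimage_def Int_def)
    then have "closed {z \<in> S. f x z \<le> t - inverse (real (Suc k))}"
      using closedin_closed_trans compact_imp_closed[OF S] by blast
    then have "closure D \<subseteq> {z \<in> S. f x z \<le> t - inverse (real (Suc k))}"
      by (rule closure_minimal[rotated]) (use k D in auto)
    then have "f x z \<le> t - inverse (real (Suc k))" if "z \<in> S" for z
      using D(3) that by blast
    moreover have "0 < inverse (real (Suc k))" by simp
    ultimately show "\<forall>z\<in>S. f x z < t" by (smt (verit))
  qed
  then have "{x \<in> space M. \<forall>z\<in>S. f x z < t} =
      {x \<in> space M. \<exists>k. \<forall>z\<in>D. f x z \<le> t - inverse (real (Suc k))}"
    by blast
  also have "\<dots> \<in> sets M"
    by (intro sets.sets_Collect_countable_Ex sets.sets_Collect_countable_All' D(1)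
        borel_measurable_le meas borel_measurable_const) (use D(2) in auto)
  finally show ?thesis .
qed

lemma measurable_sol:
  assumes "\<And>k. 1 \<le> k \<Longrightarrow> k < l \<Longrightarrow> (\<lambda>x. s x k) \<in> borel_measurable F"
  shows "(\<lambda>x. sol E d (s x) a b l j) \<in> borel_measurable F"
  using assms
proof (induction l arbitrary: j rule: less_induct)
  case (less l)
  consider "l = 0" | "l = Suc 0" | m where "l = Suc (Suc m)"
    by (metis not0_implies_Suc)
  then show ?case
  proof cases
    case 3
    have 0: "(\<lambda>x. sol E d (s x) a b m j) \<in> borel_measurable F" for j
      using less 3 by auto
    have 1: "(\<lambda>x. sol E d (s x) a b (Suc m) j) \<in> borel_measurable F" for j
      using less 3 by auto
    have 2: "(\<lambda>x. shift (sol E d (s x) a b (Suc m)) j) \<in> borel_measurable F"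
      using 1 by (cases j) auto
    have 3: "(\<lambda>x. s x (Suc m)) \<in> borel_measurable F"
      using less.prems[of "Suc m"] \<open>l = Suc (Suc m)\<close> by simp
    show ?thesis
      unfolding \<open>l = Suc (Suc m)\<close> sol.simps
      by (intro borel_measurable_diff borel_measurable_add borel_measurable_times
          borel_measurable_const 0 1 2 3)
  qed simp_all
qed

lemma sets_transfer_bounded:
  assumes R: "0 < R" and \<omega>: "\<And>k. 1 \<le> k \<Longrightarrow> \<omega> k \<in> borel_measurable M"
  shows "{x \<in> space M. transfer_bounded E R \<sigma> n (\<lambda>k. \<omega> k x) t} \<in> sets M"
proof -
  let ?f = "\<lambda>l x z. \<Sum>(a, b)\<in>{(1, 0), (0, 1)}.
    (cmod (peval n (sol E (2 * R / (rho E * real n)) (\<lambda>k. \<sigma> / sqrt (real n) * \<omega> k x) a b (Suc l))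
      (z / of_real (2 * R))))\<^sup>2
    + (cmod (peval n (sol E (2 * R / (rho E * real n)) (\<lambda>k. \<sigma> / sqrt (real n) * \<omega> k x) a b l)
      (z / of_real (2 * R))))\<^sup>2"
  have "{x \<in> space M. transfer_bounded E R \<sigma> n (\<lambda>k. \<omega> k x) t} =
      {x \<in> space M. \<forall>l\<in>{..n}. \<forall>z\<in>cball 0 R. ?f l x z < t}"
    using R by (auto simp: transfer_bounded_def tr_transfer_eq_peval)
  also have "\<dots> \<in> sets M"
  proof (rule sets.sets_Collect_finite_All)
    fix l assume "l \<in> {..n}"
    have s: "(\<lambda>x. sol E (2 * R / (rho E * real n)) (\<lambda>k. \<sigma> / sqrt (real n) * \<omega> k x) a b m j)
        \<in> borel_measurable M" for a b m j
      by (rule measurable_sol) (use \<omega> in auto)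
    show "{x \<in> space M. \<forall>z\<in>cball 0 R. ?f l x z < t} \<in> sets M"
    proof (rule sets_forall_less_compact)
      show "continuous_on (cball 0 R) (?f l x)" for x
        using R by (auto simp: peval_def intro!: continuous_intros)
      show "(\<lambda>x. ?f l x z) \<in> borel_measurable M" for z
        unfolding peval_def using s by simp
    qed simp
  qed simp
  finally show ?thesis .
qed

section \<open>Tail bound for the maximal energy\<close>

text \<open>The energy of the solutions driven by the noise \<open>\<tau> * X k\<close> meets the assumptions of
  \<open>nearly_martingale\<close>; the initial value \<open>2\<close> is the energy of the two unit vectors.\<close>

lemma (in prob_space) total_energy_maximal_inequality:
  fixes E d \<tau> a t :: real and N n :: nat
  assumes indep: "indep_vars (\<lambda>_. borel) X {1..}"
    and "\<And>k. k \<ge> 1 \<Longrightarrow> integrable M (X k)"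
    and "\<And>k. k \<ge> 1 \<Longrightarrow> expectation (X k) = 0"
    and "\<And>k. k \<ge> 1 \<Longrightarrow> integrable M (\<lambda>x. (X k x)\<^sup>2)"
    and "\<And>k. k \<ge> 1 \<Longrightarrow> expectation (\<lambda>x. (X k x)\<^sup>2) = 1"
    and E: "\<bar>E\<bar> < 2" and d: "0 \<le> d" and \<tau>: "0 \<le> \<tau>"
    and small: "3 * d + d\<^sup>2 + \<tau>\<^sup>2 \<le> (1 - \<bar>E\<bar> / 2) * a" and a_half: "a \<le> 1 / 2" and t: "0 < t"
  defines "A \<equiv> {x \<in> space M. \<exists>l\<le>n. t \<le> total_energy E d N (\<lambda>k. \<tau> * X k x) l}"
  shows "A \<in> events" and "prob A \<le> exp (3 * (real n * a)) * 2 / t"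
proof -
  define start :: "(real \<times> real) set" where "start = {(1, 0), (0, 1)}"
  define \<theta> where "\<theta> = 1 - \<bar>E\<bar> / 2"
  have \<theta>: "0 < \<theta>" using E by (simp add: \<theta>_def)
  have "0 \<le> 3 * d + d\<^sup>2 + \<tau>\<^sup>2" using d by simp
  then have "0 \<le> \<theta> * a" using small by (simp add: \<theta>_def)
  then have a: "0 \<le> a" using \<theta> by (simp add: zero_le_mult_iff)
  define K where "K = ((3 + 2 * d) * \<tau> + \<tau>\<^sup>2) / \<theta>"
  define u where "u x = (\<lambda>(a, b). sol E d (\<lambda>k. \<tau> * X k x) a b)" for x
  define Y where "Y l x = (\<Sum>p\<in>start. energy E N (u x p (Suc l)) (u x p l))" for l x
  define D where "D l x = (\<Sum>p\<in>start. energy_const E d N (u x p (Suc l)) (u x p l))" for l x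
  define L where "L l x = \<tau> * (\<Sum>p\<in>start. energy_lin E d N (u x p (Suc l)) (u x p l))" for l x
  define Q where "Q l x = \<tau>\<^sup>2 * (\<Sum>p\<in>start. energy_quad N (u x p (Suc l)))" for l x
  define S where "S x y = (\<Sum>j\<le>N. (x j)\<^sup>2 + (y j)\<^sup>2)" for x y :: "nat \<Rightarrow> real"
  have S_nonneg: "0 \<le> S x y" for x y
    by (simp add: S_def sum_nonneg)
  have S: "\<theta> * S x y \<le> energy E N x y" for x y
    unfolding S_def \<theta>_def by (rule energy_lower)
  \<comment> \<open>The plain \<open>\<ell>\<^sup>2\<close> size of the coefficients, comparable with the energy, absorbs all error terms.\<close>
  define SS where "SS l x = (\<Sum>p\<in>start. S (u x p (Suc l)) (u x p l))" for l x
  have SS_nonneg: "0 \<le> SS l x" for l x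
    by (simp add: SS_def sum_nonneg S_nonneg)
  have SS: "\<theta> * SS l x \<le> Y l x" for l x
    unfolding SS_def Y_def sum_distrib_left by (intro sum_mono S)
  have E': "\<bar>E\<bar> \<le> 2" using E by simp
  have lin: "\<bar>energy_lin E d N x y\<bar> \<le> (3 + 2 * d) * S x y"
    and quad: "\<bar>energy_quad N x\<bar> \<le> S x y"
    and dr: "\<bar>energy_const E d N x y + \<tau>\<^sup>2 * energy_quad N x - energy E N x y\<bar>
      \<le> (3 * d + d\<^sup>2 + \<tau>\<^sup>2) * S x y" for x y
    unfolding S_def by (rule energy_lin_bound[OF E' d] energy_quad_bound[OF E' d]
        energy_drift_bound[OF E' d])+
  have u_meas: "(\<lambda>x. u x p l j) \<in> borel_measurable (past M X m)"
    if "l \<le> Suc m" for p l j m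
  proof -
    have "(\<lambda>x. sol E d (\<lambda>k. \<tau> * X k x) p q l j) \<in> borel_measurable (past M X m)" for p q
      by (rule measurable_sol) (use that in \<open>auto intro!: borel_measurable_times measurable_past_component\<close>)
    then show ?thesis by (cases p) (simp add: u_def)
  qed
  have shift_meas: "(\<lambda>x. shift (u x p l) j) \<in> borel_measurable (past M X m)"
    if "l \<le> Suc m" for p l j m
    using u_meas[OF that] by (cases j) auto
  interpret nearly_martingale M X Y D L Q 2 a K
  proof
    show "indep_vars (\<lambda>_. borel) X {1..}" by fact
    show "integrable M (X k)" "expectation (X k) = 0" "integrable M (\<lambda>x. (X k x)\<^sup>2)"
      "expectation (\<lambda>x. (X k x)\<^sup>2) = 1" if "k \<ge> 1" for k
      using assms(2-5)[OF that] by auto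
  next
    show "Y 0 x = 2" for x
    proof -
      have "energy E N (\<lambda>j. if j = 0 then p else 0) (\<lambda>j. if j = 0 then q else 0) = form E p q"
        for p q
      proof -
        have "energy E N (\<lambda>j. if j = 0 then p else 0) (\<lambda>j. if j = 0 then q else 0)
            = (\<Sum>j\<le>N. if j = 0 then form E p q else 0)"
          unfolding energy_def by (rule sum.cong) (auto simp: form_def)
        then show ?thesis by simp
      qed
      from this[of 1 0] this[of 0 1] show ?thesis
        by (simp add: Y_def start_def u_def form_def)
    qed
    show "Y (Suc l) x = D l x + X (Suc l) x * L l x + (X (Suc l) x)\<^sup>2 * Q l x" for l x
    proof -
      have "energy E N (u x p (Suc (Suc l))) (u x p (Suc l)) =
        energy_const E d N (u x p (Suc l)) (u x p l)
        + \<tau> * X (Suc l) x * energy_lin E d N (u x p (Suc l)) (u x p l)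
        + (\<tau> * X (Suc l) x)\<^sup>2 * energy_quad N (u x p (Suc l))" for p
      proof -
        have "u x p (Suc (Suc l)) = (\<lambda>j. (E - \<tau> * X (Suc l) x) * u x p (Suc l) j
            + d * shift (u x p (Suc l)) j - u x p l j)"
        proof (cases p)
          case (Pair q r)
          show ?thesis unfolding Pair u_def prod.case sol.simps by (rule refl)
        qed
        then show ?thesis by (simp only: energy_step)
      qed
      then show ?thesis
        by (simp add: Y_def D_def L_def Q_def sum.distrib sum_distrib_left
            power_mult_distrib mult_ac)
    qed
    show "0 \<le> Y l x" for l x
      using SS[of l x] SS_nonneg[of l x] \<theta> by (smt (verit) mult_nonneg_nonneg)
  next
    note meas_rules = borel_measurable_sum borel_measurable_add borel_measurable_diff
      borel_measurable_times borel_measurable_power borel_measurable_const u_meas shift_meas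
    show "Y k \<in> borel_measurable (past M X l)" if "k \<le> l" for k l
      unfolding Y_def energy_def form_def by (intro meas_rules) (use that in auto)
    show "D l \<in> borel_measurable (past M X l)" for l
      unfolding D_def energy_const_def form_def by (intro meas_rules) auto
    show "L l \<in> borel_measurable (past M X l)" for l
      unfolding L_def energy_lin_def by (intro meas_rules) auto
    show "Q l \<in> borel_measurable (past M X l)" for l
      unfolding Q_def energy_quad_def by (intro meas_rules) auto
  next
    have K_eq: "((3 + 2 * d) * \<tau> + \<tau>\<^sup>2) * SS l x \<le> K * Y l x" for l x
    proof -
      have "((3 + 2 * d) * \<tau> + \<tau>\<^sup>2) * SS l x = K * (\<theta> * SS l x)"
        using \<theta> by (simp add: K_def)
      also have "\<dots> \<le> K * Y l x"
        using \<theta> d \<tau> by (intro mult_left_mono SS) (simp add: K_def)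
      finally show ?thesis .
    qed
    show "\<bar>L l x\<bar> \<le> K * Y l x" for l x
    proof -
      have "\<bar>L l x\<bar> \<le> \<tau> * (\<Sum>p\<in>start. \<bar>energy_lin E d N (u x p (Suc l)) (u x p l)\<bar>)"
        unfolding L_def abs_mult using \<tau> by (simp add: mult_left_mono sum_abs)
      also have "\<dots> \<le> \<tau> * ((3 + 2 * d) * SS l x)"
        unfolding SS_def sum_distrib_left[of "3 + 2 * d"]
        using \<tau> by (intro mult_left_mono sum_mono lin)
      also have "\<dots> \<le> ((3 + 2 * d) * \<tau> + \<tau>\<^sup>2) * SS l x"
        using SS_nonneg[of l x] by (simp add: algebra_simps)
      finally show ?thesis using K_eq[of l x] by simp
    qed
    show "\<bar>Q l x\<bar> \<le> K * Y l x" for l x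
    proof -
      have "\<bar>Q l x\<bar> \<le> \<tau>\<^sup>2 * (\<Sum>p\<in>start. \<bar>energy_quad N (u x p (Suc l))\<bar>)"
        unfolding Q_def abs_mult by (simp add: mult_left_mono sum_abs)
      also have "\<dots> \<le> \<tau>\<^sup>2 * SS l x"
        unfolding SS_def by (intro mult_left_mono sum_mono quad) auto
      also have "\<dots> \<le> ((3 + 2 * d) * \<tau> + \<tau>\<^sup>2) * SS l x"
        using SS_nonneg[of l x] \<tau> d by (simp add: distrib_right)
      finally show ?thesis using K_eq[of l x] by simp
    qed
    show "\<bar>D l x + Q l x - Y l x\<bar> \<le> a * Y l x" for l x
    proof -
      have "D l x + Q l x - Y l x = (\<Sum>p\<in>start. energy_const E d N (u x p (Suc l)) (u x p l)
          + \<tau>\<^sup>2 * energy_quad N (u x p (Suc l)) - energy E N (u x p (Suc l)) (u x p l))"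
        by (simp add: D_def Q_def Y_def sum.distrib sum_subtractf sum_distrib_left)
      then have "\<bar>D l x + Q l x - Y l x\<bar> \<le> (\<Sum>p\<in>start. \<bar>energy_const E d N (u x p (Suc l)) (u x p l)
          + \<tau>\<^sup>2 * energy_quad N (u x p (Suc l)) - energy E N (u x p (Suc l)) (u x p l)\<bar>)"
        by (simp only: sum_abs)
      also have "\<dots> \<le> (3 * d + d\<^sup>2 + \<tau>\<^sup>2) * SS l x"
        unfolding SS_def sum_distrib_left[of "3 * d + d\<^sup>2 + \<tau>\<^sup>2"]
        by (intro sum_mono dr)
      also have "\<dots> \<le> \<theta> * a * SS l x"
        by (intro mult_right_mono small[folded \<theta>_def] SS_nonneg)
      also have "\<dots> = a * (\<theta> * SS l x)"
        by simp
      also have "\<dots> \<le> a * Y l x"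
        using a by (intro mult_left_mono SS) auto
      finally show ?thesis .
    qed
  qed
  have A: "A = {x \<in> space M. \<exists>l\<le>n. t \<le> Y l x}"
    by (simp add: A_def Y_def total_energy_def start_def u_def)
  show "A \<in> events"
    unfolding A by (rule events_of_past[OF measurable_exceed])
  show "prob A \<le> exp (3 * (real n * a)) * 2 / t"
    unfolding A using a a_half t by (intro maximal_inequality) auto
qed

section \<open>The theorem\<close>

theorem theorem1:
  fixes M :: "'a measure" and \<omega> :: "nat \<Rightarrow> 'a \<Rightarrow> real" and E R \<sigma> :: real
  assumes "prob_space M"
    and "prob_space.indep_vars M (\<lambda>_. borel) \<omega> {1..}"
    and "\<And>k. k \<ge> 1 \<Longrightarrow> integrable M (\<omega> k)"
    and "\<And>k. k \<ge> 1 \<Longrightarrow> prob_space.expectation M (\<omega> k) = 0"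
    and "\<And>k. k \<ge> 1 \<Longrightarrow> integrable M (\<lambda>x. (\<omega> k x)\<^sup>2)"
    and "\<And>k. k \<ge> 1 \<Longrightarrow> prob_space.variance M (\<omega> k) = 1"
    and "\<And>k. k \<ge> 1 \<Longrightarrow> integrable M (\<lambda>x. \<bar>\<omega> k x\<bar> ^ 3)"
    and "bdd_above ((\<lambda>k. prob_space.expectation M (\<lambda>x. \<bar>\<omega> k x\<bar> ^ 3)) ` {1..})"
    and "E \<in> {-2<..<2}" and "0 < R" and "0 \<le> \<sigma>"
  shows "\<exists>c::real. \<forall>\<^sub>F n in sequentially. \<forall>t>0.
    \<P>(x in M. transfer_bounded E R \<sigma> n (\<lambda>k. \<omega> k x) t \<and>
              eigenvectors_delocalized E R \<sigma> n (\<lambda>k. \<omega> k x) t) \<ge> 1 - c / t"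
proof -
  interpret prob_space M by fact
  note R = \<open>0 < R\<close>
  have E: "\<bar>E\<bar> < 2" using assms(9) by auto
  define \<theta> where "\<theta> = 1 - \<bar>E\<bar> / 2"
  have \<theta>: "0 < \<theta>" using E by (simp add: \<theta>_def)
  \<comment> \<open>The energy drifts by a factor between \<open>1 - C / n\<close> and \<open>1 + C / n\<close> per step.\<close>
  define C where "C = (6 * R + 4 * R\<^sup>2 + \<sigma>\<^sup>2) / \<theta>"
  have C: "0 \<le> C" using \<theta> R by (simp add: C_def)
  \<comment> \<open>The factor that turns a bound on the energy into a bound on the traces.\<close>
  define \<kappa> where "\<kappa> = 4 / (3 * \<theta>)"
  have \<kappa>: "0 < \<kappa>" using \<theta> by (simp add: \<kappa>_def)
  have \<omega>: "\<omega> k \<in> borel_measurable M" if "1 \<le> k" for k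
    using assms(3)[OF that] by simp
  have "1 - exp (3 * C) * 2 * \<kappa> / t \<le> \<P>(x in M. transfer_bounded E R \<sigma> n (\<lambda>k. \<omega> k x) t \<and>
              eigenvectors_delocalized E R \<sigma> n (\<lambda>k. \<omega> k x) t)"
    if n: "0 < n" "2 * C \<le> real n" and t: "0 < t" for n t
  proof -
    define d where "d = 2 * R / (rho E * real n)"
    define \<tau> where "\<tau> = \<sigma> / sqrt (real n)"
    \<comment> \<open>Since \<open>\<rho> \<ge> 1\<close>, both the shift \<open>d\<close> and the noise variance \<open>\<tau>\<^sup>2\<close> are of order \<open>1 / n\<close>.\<close>
    have d: "0 \<le> d" "d \<le> 2 * R / real n"
    proof -
      show "0 \<le> d"
        using R rho_ge_1[OF E] n by (simp add: d_def)
      have "real n \<le> rho E * real n"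
        using rho_ge_1[OF E] n by simp
      then show "d \<le> 2 * R / real n"
        unfolding d_def using R n by (intro divide_left_mono) auto
    qed
    have \<tau>: "0 \<le> \<tau>" "\<tau>\<^sup>2 = \<sigma>\<^sup>2 / real n"
      using \<open>0 \<le> \<sigma>\<close> by (simp_all add: \<tau>_def power_divide)
    have small: "3 * d + d\<^sup>2 + \<tau>\<^sup>2 \<le> \<theta> * (C / real n)"
    proof -
      have "d\<^sup>2 \<le> (2 * R / real n)\<^sup>2"
        using d by (intro power_mono) auto
      also have "\<dots> = 4 * R\<^sup>2 / real n / real n"
        by (simp add: power2_eq_square)
      also have "\<dots> \<le> 4 * R\<^sup>2 / real n"
        using n by (simp add: divide_le_eq mult_le_cancel_left1)
      finally have "3 * d + d\<^sup>2 + \<tau>\<^sup>2 \<le> 3 * (2 * R / real n) + 4 * R\<^sup>2 / real n + \<sigma>\<^sup>2 / real n"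
        using d \<tau> by simp
      also have "\<dots> = \<theta> * (C / real n)"
        using \<theta> n by (simp add: C_def field_simps)
      finally show ?thesis .
    qed
    let ?A = "{x \<in> space M. \<exists>l\<le>n. t / \<kappa> \<le> total_energy E d n (\<lambda>k. \<tau> * \<omega> k x) l}"
    let ?G = "{x \<in> space M. transfer_bounded E R \<sigma> n (\<lambda>k. \<omega> k x) t}"
    have second_moment: "expectation (\<lambda>x. (\<omega> k x)\<^sup>2) = 1" if "k \<ge> 1" for k
      using assms(4,6)[OF that] by simp
    note tail = total_energy_maximal_inequality[OF assms(2-5) second_moment E d(1) \<tau>(1)
        small[unfolded \<theta>_def], where t = "t / \<kappa>" and n = n and N = n]
    have half: "C / real n \<le> 1 / 2" and pos: "0 < t / \<kappa>"
      using n t \<kappa> by (auto simp: field_simps)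
    have A_ev: "?A \<in> events"
      by (rule tail(1)[OF _ _ _ _ half pos])
    have "prob ?A \<le> exp (3 * (real n * (C / real n))) * 2 / (t / \<kappa>)"
      by (rule tail(2)[OF _ _ _ _ half pos])
    then have A: "prob ?A \<le> exp (3 * C) * 2 * \<kappa> / t"
      using n by simp
    have sub: "space M - ?A \<subseteq> ?G"
    proof
      fix x assume "x \<in> space M - ?A"
      then have x: "x \<in> space M"
        and Y: "\<And>l. l \<le> n \<Longrightarrow> total_energy E d n (\<lambda>k. \<tau> * \<omega> k x) l < t / \<kappa>"
        by (blast, force simp: not_le)
      have "tr_AAstar (transfer E \<sigma> n (\<lambda>k. \<omega> k x) z l) < t" if "l \<le> n" "cmod z \<le> R" for l z
      proof -
        have "tr_AAstar (transfer E \<sigma> n (\<lambda>k. \<omega> k x) z l)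
            \<le> \<kappa> * total_energy E d n (\<lambda>k. \<tau> * \<omega> k x) l"
          using tr_transfer_le_energy[OF E R that, of \<sigma> "\<lambda>k. \<omega> k x"]
          by (simp add: \<kappa>_def \<theta>_def d_def \<tau>_def)
        also have "\<dots> < t"
          using Y[OF that(1)] \<kappa> by (simp add: field_simps)
        finally show ?thesis .
      qed
      then show "x \<in> ?G"
        using x by (simp add: transfer_bounded_def)
    qed
    have "1 - exp (3 * C) * 2 * \<kappa> / t \<le> 1 - prob ?A"
      using A by simp
    also have "\<dots> = prob (space M - ?A)"
      by (rule prob_compl[OF A_ev, symmetric])
    also have "\<dots> \<le> prob ?G"
      by (rule finite_measure_mono[OF sub sets_transfer_bounded[OF R \<omega>]])
    also have "?G = {x \<in> space M. transfer_bounded E R \<sigma> n (\<lambda>k. \<omega> k x) t \<and>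
              eigenvectors_delocalized E R \<sigma> n (\<lambda>k. \<omega> k x) t}"
      using delocalized_if_transfer_bounded[OF E n(1)] by blast
    finally show ?thesis .
  qed
  moreover have "\<forall>\<^sub>F n in sequentially. 0 < n \<and> 2 * C \<le> real n"
    by (intro eventually_conj eventually_gt_at_top)
      (use eventually_ge_at_top[of "nat \<lceil>2 * C\<rceil>"] in \<open>auto elim!: eventually_mono simp: nat_ceiling_le_eq\<close>)
  ultimately show ?thesis
    by (intro exI[of _ "exp (3 * C) * 2 * \<kappa>"]) (auto elim!: eventually_mono)
qed

end
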